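(* Let $f:\mathbb{R}^n\to\mathbb{R}$ and $g=(g_1,\dots,g_q):\mathbb{R}^n\to\mathbb{R}^q$ be locally Lipschitz continuous, and let $\bar{x}$ be a local minimizer of the problem (P): $\min_x f(x)$ subject to $g(x)\le 0$. Then quasinormality at $\bar{x}$ strictly implies subMFC at $\bar{x}$; that is, if $\bar x$ satisfies quasinormality then subMFC holds at $\bar x$, and the converse fails in general: there exist an instance of (P) with locally Lipschitz continuous data and a local minimizer of it at which subMFC holds but quasinormality does not.
   Context: Inequalities between vectors are componentwise; sums and multiples of sets are in the Minkowski sense, and an empty sum is $\{0\}$. For a locally Lipschitz $\phi:\mathbb{R}^n\to\mathbb{R}$, $\partial\phi(\bar x)$ is the Clarke subdifferential: $\partial\phi(\bar x)=\{s\in\mathbb{R}^n : s^\top d\le \phi^\circ(\bar x;d)\ \forall d\in\mathbb{R}^n\}$ with $\phi^\circ(\bar x;d)=\limsup_{x\to\bar x,\,h\downarrow 0}\frac{\phi(x+hd)-\phi(x)}{h}$. AKKT sequence for $\bar x$: a sequence $\{(x^k,u^k,\delta^k,\epsilon^k)\}_{k=1}^\infty\subset\mathbb{R}^n\times\mathbb{R}^q\times\mathbb{R}^q\times\mathbb{R}^n$ such that for all $k\in\mathbb{N}$: $\epsilon^k\in\partial f(x^k)+\sum_{j=1}^q u^k_j\partial g_j(x^k)$, $u^k\ge 0$, $g(x^k)\le\delta^k$, $(u^k)^\top(g(x^k)-\delta^k)=0$; and $(x^k,\delta^k,\epsilon^k)\to(\bar x,0,0)$ as $k\to\infty$. Active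 sets: $I(\bar x)=\{j\in\{1,\dots,q\}: g_j(\bar x)=0\}$; for $g(x)\le\delta$, $I(x,\delta)=\{j\in\{1,\dots,q\}: g_j(x)=\delta_j\}$. subMFC (Subset Mangasarian-Fromovitz Condition) holds at a feasible point $\bar x$ if there exists $I\subseteq I(\bar x)$ such that: (i) if $I\neq\emptyset$, then for all $v=(v_j)_{j\in I}\ge 0$, $v\ne 0$, one has $0\notin\sum_{j\in I}v_j\partial g_j(\bar x)$; (ii) there exists an AKKT sequence for $\bar x$ with $I=I(x^k,\delta^k)$ for all $k\in\mathbb{N}$. Quasinormality: a feasible point $\bar x$ satisfies quasinormality if there is no multiplier $v=(v_j)_{j\in I(\bar x)}\ge 0$, $v\ne 0$, such that both: (b1) $0\in\sum_{j\in I(\bar x)}v_j\partial g_j(\bar x)$; and (b2) there is a sequence $\{x^k\}_{k=1}^\infty$ with $x^k\to\bar x$ such that, for all $k\in\mathbb{N}$, $v_jg_j(x^k)>0$ for all $j$ with $v_j>0$. *)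

theory Defs
  imports "HOL-Analysis.Analysis" "HOL-Library.Set_Algebras"
begin

definition locally_lipschitz :: "('a::metric_space \<Rightarrow> 'b::metric_space) \<Rightarrow> bool" where
  "locally_lipschitz \<phi> \<longleftrightarrow> (\<forall>x. \<exists>r>0. \<exists>L. L-lipschitz_on (ball x r) \<phi>)"

text \<open>The base point \<open>y\<close> is allowed to equal \<open>x\<close>, hence \<open>nhds x\<close> rather than \<open>at x\<close>. The upper
  limit is taken in \<^typ>\<open>ereal\<close>; it is finite when \<open>\<phi>\<close> is locally Lipschitz.\<close>

definition clarke_deriv :: "('a::euclidean_space \<Rightarrow> real) \<Rightarrow> 'a \<Rightarrow> 'a \<Rightarrow> ereal" where
  "clarke_deriv \<phi> x d =
     Limsup (nhds x \<times>\<^sub>F at_right 0) (\<lambda>(y, h). ereal ((\<phi> (y + h *\<^sub>R d) - \<phi> y) / h))"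

definition clarke_subdiff :: "('a::euclidean_space \<Rightarrow> real) \<Rightarrow> 'a \<Rightarrow> 'a set" where
  "clarke_subdiff \<phi> x = {s. \<forall>d. ereal (s \<bullet> d) \<le> clarke_deriv \<phi> x d}"

text \<open>The sum below is the Minkowski sum of sets from \<^theory>\<open>HOL-Library.Set_Algebras\<close>, whose zero
  is \<open>{0}\<close>; in particular the sum over an empty \<open>J\<close> is \<open>{0}\<close>.\<close>

definition weighted_subdiff_sum ::
    "('a::euclidean_space \<Rightarrow> real ^ 'q) \<Rightarrow> 'q set \<Rightarrow> ('q \<Rightarrow> real) \<Rightarrow> 'a \<Rightarrow> 'a set" where
  "weighted_subdiff_sum g J v x =
     (\<Sum>j\<in>J. (\<lambda>s. v j *\<^sub>R s) ` clarke_subdiff (\<lambda>y. g y $ j) x)"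

text \<open>The order on \<open>real ^ 'q\<close> is the componentwise one.\<close>

definition feasible :: "('a \<Rightarrow> real ^ 'q) \<Rightarrow> 'a \<Rightarrow> bool" where
  "feasible g x \<longleftrightarrow> g x \<le> 0"

definition local_minimizer ::
    "('a::topological_space \<Rightarrow> real) \<Rightarrow> ('a \<Rightarrow> real ^ 'q) \<Rightarrow> 'a \<Rightarrow> bool" where
  "local_minimizer f g x \<longleftrightarrow>
     feasible g x \<and> (\<forall>\<^sub>F y in nhds x. feasible g y \<longrightarrow> f x \<le> f y)"

definition active_set :: "('a \<Rightarrow> real ^ 'q) \<Rightarrow> 'a \<Rightarrow> real ^ 'q \<Rightarrow> 'q set" where
  "active_set g x \<delta> = {j. g x $ j = \<delta> $ j}"

definition akkt_sequence ::
    "('a::euclidean_space \<Rightarrow> real) \<Rightarrow> ('a \<Rightarrow> real ^ 'q) \<Rightarrow> 'a \<Rightarrow>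
     (nat \<Rightarrow> 'a) \<Rightarrow> (nat \<Rightarrow> real ^ 'q) \<Rightarrow> (nat \<Rightarrow> real ^ 'q) \<Rightarrow> (nat \<Rightarrow> 'a) \<Rightarrow> bool" where
  "akkt_sequence f g xbar x u \<delta> \<epsilon> \<longleftrightarrow>
     (\<forall>k. \<epsilon> k \<in> clarke_subdiff f (x k) + weighted_subdiff_sum g UNIV (\<lambda>j. u k $ j) (x k) \<and>
          u k \<ge> 0 \<and> g (x k) \<le> \<delta> k \<and> u k \<bullet> (g (x k) - \<delta> k) = 0) \<and>
     x \<longlonglongrightarrow> xbar \<and> \<delta> \<longlonglongrightarrow> 0 \<and> \<epsilon> \<longlonglongrightarrow> 0"

text \<open>A family \<open>(v\<^sub>j)\<close> indexed by a subset \<open>J\<close> of the constraint indices is encoded as a total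
  function of which only the values on \<open>J\<close> are used.\<close>

definition nonzero_multiplier :: "'q set \<Rightarrow> ('q \<Rightarrow> real) \<Rightarrow> bool" where
  "nonzero_multiplier J v \<longleftrightarrow> (\<forall>j\<in>J. v j \<ge> 0) \<and> (\<exists>j\<in>J. v j \<noteq> 0)"

definition subMFC ::
    "('a::euclidean_space \<Rightarrow> real) \<Rightarrow> ('a \<Rightarrow> real ^ 'q) \<Rightarrow> 'a \<Rightarrow> bool" where
  "subMFC f g xbar \<longleftrightarrow> feasible g xbar \<and>
     (\<exists>J \<subseteq> active_set g xbar 0.
        (J \<noteq> {} \<longrightarrow>
           (\<forall>v. nonzero_multiplier J v \<longrightarrow> 0 \<notin> weighted_subdiff_sum g J v xbar)) \<and>
        (\<exists>x u \<delta> \<epsilon>. akkt_sequence f g xbar x u \<delta> \<epsilon> \<and> (\<forall>k. J = active_set g (x k) (\<delta> k))))"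

definition quasinormal :: "('a::euclidean_space \<Rightarrow> real ^ 'q) \<Rightarrow> 'a \<Rightarrow> bool" where
  "quasinormal g xbar \<longleftrightarrow> feasible g xbar \<and>
     (let A = active_set g xbar 0 in
      \<not> (\<exists>v. nonzero_multiplier A v \<and>
             0 \<in> weighted_subdiff_sum g A v xbar \<and>
             (\<exists>x. x \<longlonglongrightarrow> xbar \<and> (\<forall>k::nat. \<forall>j\<in>A. v j > 0 \<longrightarrow> v j * g (x k) $ j > 0))))"

end

theory Submission imports Defs begin

text \<open>Near a local minimizer \<open>xbar\<close>, minimize \<open>f + K/2 \<Sum>\<^sub>j (max 0 g\<^sub>j)\<^sup>2 + \<parallel>\<sqdot> - xbar\<parallel>\<^sup>2/2\<close> over a small ball. For
  large \<open>K\<close> the minimizer \<open>x\<close> is interior, so it satisfies the AKKT inclusion with multipliers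
  \<open>K max 0 (g\<^sub>j x)\<close> and error \<open>xbar - x\<close>. Along a subsequence the set \<open>J\<close> of violated constraints is
  constant; setting \<open>\<delta>\<^sub>j = g\<^sub>j x\<close> on \<open>J\<close> and \<open>\<delta>\<^sub>j > 0\<close> off \<open>J\<close> makes \<open>J\<close> the active set. A
  multiplier on \<open>J\<close> contradicting subMFC, extended by zero, would contradict quasinormality, because
  the constraints in \<open>J\<close> are positive along that very subsequence.

  For the converse, \<open>f = 0\<close> and \<open>g\<^sub>j = norm\<close> at the origin: the constant sequence with slack
  \<open>\<delta>\<^sub>j > 0\<close> has an empty active set.\<close>

section \<open>Support functions of compact convex sets\<close>

text \<open>Says that \<open>p\<close> is at most the support function of the compact convex set
  \<open>C\<close>. In this form the bound passes to Minkowski sums and nonnegative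
  multiples.\<close>

definition supports :: "'a::euclidean_space set \<Rightarrow> ('a \<Rightarrow> real) \<Rightarrow> bool" where
  "supports C p \<longleftrightarrow> compact C \<and> convex C \<and> (\<forall>d. \<exists>s\<in>C. p d \<le> s \<bullet> d)"

lemma supports_plus:
  assumes "supports C p" "supports D r"
  shows "supports (C + D) (\<lambda>d. p d + r d)"
proof -
  have "compact (C + D)"
    using compact_sums[of C D] assms by (simp add: supports_def set_plus_def Collect_ex_eq Bex_def conj_ac)
  moreover have "\<exists>s\<in>C + D. p d + r d \<le> s \<bullet> d" for d
  proof -
    obtain s t where "s \<in> C" "p d \<le> s \<bullet> d" "t \<in> D" "r d \<le> t \<bullet> d"
      using assms by (meson supports_def)
    then show ?thesis
      by (intro bexI[of _ "s + t"]) (auto simp: inner_add_left)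
  qed
  ultimately show ?thesis
    using assms by (auto simp: supports_def intro: convex_set_plus)
qed

lemma supports_scaleR:
  assumes "supports C p" "c \<ge> 0"
  shows "supports ((*\<^sub>R) c ` C) (\<lambda>d. c * p d)"
  using assms by (fastforce simp: supports_def intro: compact_scaling convex_scaling mult_left_mono)

lemma supports_sum:
  assumes "finite J" "\<And>j. j \<in> J \<Longrightarrow> supports (C j) (p j)"
  shows "supports (\<Sum>j\<in>J. C j) (\<lambda>d. \<Sum>j\<in>J. p j d)"
  using assms
proof (induction J rule: finite_induct)
  case empty
  then show ?case by (simp add: supports_def)
next
  case (insert j J)
  then show ?case using supports_plus[of "C j" "p j"] by simp
qed

text \<open>If \<open>w\<close> were outside \<open>C\<close>, a hyperplane with normal
  \<open>a\<close> would separate them strictly. In direction \<open>- a\<close> the point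
  \<open>w\<close> would then exceed every point of \<open>C\<close>, and with it
  \<open>p\<close>.\<close>

lemma supports_memI:
  assumes "supports C p" "\<And>d. w \<bullet> d \<le> p d"
  shows "w \<in> C"
proof (rule ccontr)
  assume "w \<notin> C"
  then obtain a b where ab: "a \<bullet> w < b" "\<And>s. s \<in> C \<Longrightarrow> b < a \<bullet> s"
    using separating_hyperplane_closed_point[of C w] assms
    by (auto simp: supports_def compact_imp_closed)
  obtain s where "s \<in> C" "p (- a) \<le> s \<bullet> (- a)"
    using assms(1) by (meson supports_def)
  then show False
    using ab(1) ab(2)[of s] assms(2)[of "- a"] by (simp add: inner_commute)
qed

text \<open>Hahn--Banach, by separating the epigraph of \<open>p\<close> from the open vertical ray below
  \<open>(d0, p d0)\<close>.\<close>

lemma sublinear_support_attained: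
  fixes p :: "'a::euclidean_space \<Rightarrow> real"
  assumes subadd: "\<And>d e. p (d + e) \<le> p d + p e"
    and homog: "\<And>c d. c > 0 \<Longrightarrow> p (c *\<^sub>R d) = c * p d"
  shows "\<exists>s. (\<forall>d. s \<bullet> d \<le> p d) \<and> p d0 \<le> s \<bullet> d0"
proof -
  have "p (2 *\<^sub>R 0) = 2 * p 0" by (rule homog) simp
  then have p0: "p 0 = 0" by simp
  let ?E = "epigraph UNIV p" and ?R = "{d0} \<times> {..<p d0}"
  have "convex_on UNIV p"
  proof (rule convex_onI)
    fix t :: real and x y assume "0 < t" "t < 1"
    then show "p ((1 - t) *\<^sub>R x + t *\<^sub>R y) \<le> (1 - t) * p x + t * p y"
      using subadd[of "(1 - t) *\<^sub>R x" "t *\<^sub>R y"] by (simp add: homog)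
  qed simp
  then have "convex ?E" by (rule convex_epigraphI)
  moreover have "convex ?R" by (intro convex_Times) auto
  moreover have "?E \<noteq> {}" "?R \<noteq> {}" "?E \<inter> ?R = {}"
    by (auto simp: epigraph_def intro: exI[of _ "p d0 - 1"])
  ultimately obtain z b where z: "z \<noteq> 0" and E: "\<forall>x\<in>?E. z \<bullet> x \<le> b" and R: "\<forall>x\<in>?R. z \<bullet> x \<ge> b"
    using separating_hyperplane_sets[of ?E ?R] by blast
  obtain a \<beta> where zab: "z = (a, \<beta>)" by (cases z)
  have E': "a \<bullet> d + \<beta> * t \<le> b" if "p d \<le> t" for d t
    using E that by (auto simp: zab epigraph_def)
  have R': "b \<le> a \<bullet> d0 + \<beta> * t" if "t < p d0" for t
    using R that by (auto simp: zab)
  \<comment> \<open>The epigraph is a cone, so a linear functional bounded above on it is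
    nonpositive there: scaling by \<open>c\<close> would raise a positive value to
    \<open>\<bar>b\<bar> + 1\<close>, beyond \<open>b\<close>.\<close>
  have cone: "a \<bullet> d + \<beta> * t \<le> 0" if "p d \<le> t" for d t
  proof (rule ccontr)
    assume pos: "\<not> a \<bullet> d + \<beta> * t \<le> 0"
    define c where "c = (\<bar>b\<bar> + 1) / (a \<bullet> d + \<beta> * t)"
    have "c > 0" using pos by (simp add: c_def)
    then have "a \<bullet> (c *\<^sub>R d) + \<beta> * (c * t) \<le> b"
      using that by (intro E') (simp add: homog)
    moreover have "a \<bullet> (c *\<^sub>R d) + \<beta> * (c * t) = c * (a \<bullet> d + \<beta> * t)"
      by (simp add: algebra_simps)
    moreover have "c * (a \<bullet> d + \<beta> * t) = \<bar>b\<bar> + 1"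
      using pos by (simp add: c_def)
    ultimately show False by linarith
  qed
  have b: "b \<ge> 0" using E'[of 0 0] p0 by simp
  have "\<beta> \<le> 0" using cone[of 0 1] p0 by simp
  \<comment> \<open>The separating hyperplane is not vertical: testing the cone inequality in
    direction \<open>a\<close> would give \<open>a = 0\<close>, so \<open>z = 0\<close>.\<close>
  moreover have "\<beta> \<noteq> 0"
  proof
    assume "\<beta> = 0"
    then have "a \<bullet> a \<le> 0" using cone[of a "p a"] by simp
    then have "a = 0" by (metis inner_gt_zero_iff not_less)
    then show False using z zab \<open>\<beta> = 0\<close> by (simp add: zero_prod_def)
  qed
  ultimately have \<beta>: "\<beta> < 0" by simp
  define s where "s = (1 / (- \<beta>)) *\<^sub>R a"
  have "s \<bullet> d \<le> p d" for d
    using cone[of d "p d"] \<beta> by (simp add: s_def field_simps)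
  moreover have "p d0 \<le> s \<bullet> d0"
  \<comment> \<open>The ray omits its end point \<open>p d0\<close>, so the bound is first proved
    for each \<open>t\<close> below it.\<close>
  proof (rule dense_le)
    fix t assume "t < p d0"
    then show "t \<le> s \<bullet> d0"
      using R'[of t] b \<beta> by (simp add: s_def field_simps)
  qed
  ultimately show ?thesis by blast
qed

section \<open>Clarke calculus\<close>

text \<open>For locally Lipschitz functions the upper limit is finite, so the conversion loses
  nothing and permits real arithmetic.\<close>

definition clarke_real :: "('a::euclidean_space \<Rightarrow> real) \<Rightarrow> 'a \<Rightarrow> 'a \<Rightarrow> real" where
  "clarke_real \<phi> x d = real_of_ereal (clarke_deriv \<phi> x d)"

section \<open>Finiteness and sublinearity of the Clarke directional derivative\<close>

lemma clarke_filter_nontrivial: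
  "nhds (x::'a::euclidean_space) \<times>\<^sub>F at_right (0::real) \<noteq> bot"
  by (simp add: prod_filter_eq_bot trivial_limit_at_right_real)

lemma tendsto_clarke_shift:
  fixes x :: "'a::euclidean_space"
  shows "((\<lambda>(y, h). y + h *\<^sub>R d) \<longlongrightarrow> x) (nhds x \<times>\<^sub>F at_right (0::real))"
proof -
  have "(fst \<longlongrightarrow> x) (nhds x \<times>\<^sub>F at_right (0::real))" by (rule filterlim_fst)
  moreover have "(snd \<longlongrightarrow> 0) (nhds x \<times>\<^sub>F at_right (0::real))"
    by (rule filterlim_mono[OF filterlim_snd _ order_refl]) (simp add: at_within_def)
  ultimately have "((\<lambda>z. fst z + snd z *\<^sub>R d) \<longlongrightarrow> x + 0 *\<^sub>R d) (nhds x \<times>\<^sub>F at_right (0::real))"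
    by (intro tendsto_intros)
  then show ?thesis by (simp add: case_prod_unfold)
qed

lemma eventually_clarke_pos:
  "\<forall>\<^sub>F (y, h) in nhds x \<times>\<^sub>F at_right (0::real). h > 0"
  using eventually_compose_filterlim[OF eventually_at_right_less filterlim_snd]
  by (simp add: case_prod_unfold)

text \<open>A Lipschitz constant on one ball around \<open>x\<close> serves all directions, since
  \<open>y\<close> and \<open>y + h *\<^sub>R d\<close> both eventually lie in that ball.\<close>

lemma clarke_quotient_bounded:
  fixes \<phi> :: "'a::euclidean_space \<Rightarrow> real"
  assumes "locally_lipschitz \<phi>"
  obtains L where "\<And>d. \<forall>\<^sub>F (y, h) in nhds x \<times>\<^sub>F at_right 0.
    \<bar>(\<phi> (y + h *\<^sub>R d) - \<phi> y) / h\<bar> \<le> L * norm d"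
proof -
  obtain r L where r: "r > 0" and L: "L-lipschitz_on (ball x r) \<phi>"
    using assms by (metis locally_lipschitz_def)
  have "\<forall>\<^sub>F (y, h) in nhds x \<times>\<^sub>F at_right 0. \<bar>(\<phi> (y + h *\<^sub>R d) - \<phi> y) / h\<bar> \<le> L * norm d" for d
  proof -
    have ball: "\<forall>\<^sub>F y in nhds x. y \<in> ball x r"
      using r by (intro eventually_nhds_in_open) auto
    have "\<forall>\<^sub>F (y, h) in nhds x \<times>\<^sub>F at_right (0::real). y + h *\<^sub>R d \<in> ball x r"
      using eventually_compose_filterlim[OF ball tendsto_clarke_shift] by (simp add: case_prod_unfold)
    moreover have "\<forall>\<^sub>F (y, h) in nhds x \<times>\<^sub>F at_right (0::real). y \<in> ball x r"
      using eventually_compose_filterlim[OF ball filterlim_fst] by (simp add: case_prod_unfold)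
    ultimately show ?thesis
      using eventually_clarke_pos
    proof eventually_elim
      case (elim z)
      obtain y h where z: "z = (y, h)" by (cases z)
      have "\<bar>\<phi> (y + h *\<^sub>R d) - \<phi> y\<bar> \<le> L * norm (h *\<^sub>R d)"
        using lipschitz_onD[OF L, of "y + h *\<^sub>R d" y] elim z by (simp add: dist_norm)
      then show ?case using elim z by (simp add: abs_divide field_simps)
    qed
  qed
  then show thesis by (rule that)
qed

lemma ereal_clarke_real:
  assumes "locally_lipschitz \<phi>"
  shows "clarke_deriv \<phi> x d = ereal (clarke_real \<phi> x d)"
proof -
  obtain L where L: "\<And>d. \<forall>\<^sub>F (y, h) in nhds x \<times>\<^sub>F at_right 0.
      \<bar>(\<phi> (y + h *\<^sub>R d) - \<phi> y) / h\<bar> \<le> L * norm d"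
    using clarke_quotient_bounded[OF assms] by blast
  have "clarke_deriv \<phi> x d \<le> ereal (L * norm d)"
    unfolding clarke_deriv_def
    by (intro Limsup_bounded eventually_mono[OF L[of d]]) (auto simp del: abs_divide)
  moreover have "ereal (- (L * norm d)) \<le> clarke_deriv \<phi> x d"
    unfolding clarke_deriv_def
    by (intro le_Limsup clarke_filter_nontrivial eventually_mono[OF L[of d]]) (auto simp del: abs_divide)
  ultimately show ?thesis
    unfolding clarke_real_def by (cases "clarke_deriv \<phi> x d") auto
qed

lemma eventually_clarke_quotient_less:
  assumes "locally_lipschitz \<phi>" "clarke_real \<phi> x d < c"
  shows "\<forall>\<^sub>F (y, h) in nhds x \<times>\<^sub>F at_right 0. (\<phi> (y + h *\<^sub>R d) - \<phi> y) / h < c"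
proof -
  have "clarke_deriv \<phi> x d < ereal c"
    using assms by (simp add: ereal_clarke_real)
  from Limsup_lessD[OF this[unfolded clarke_deriv_def]] show ?thesis
    by (simp add: case_prod_unfold)
qed

lemma clarke_real_leI:
  assumes "locally_lipschitz \<phi>"
    and "\<forall>\<^sub>F (y, h) in nhds x \<times>\<^sub>F at_right 0. (\<phi> (y + h *\<^sub>R d) - \<phi> y) / h \<le> c"
  shows "clarke_real \<phi> x d \<le> c"
proof -
  have "clarke_deriv \<phi> x d \<le> ereal c"
    unfolding clarke_deriv_def
    by (intro Limsup_bounded eventually_mono[OF assms(2)]) auto
  then show ?thesis using assms(1) by (simp add: ereal_clarke_real)
qed

text \<open>The quotient for \<open>d + e\<close> splits into one for \<open>e\<close> at
  \<open>y\<close> and one for \<open>d\<close> at \<open>y + h *\<^sub>R e\<close>. The shifted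
  base point still tends to \<open>x\<close>, and the Clarke limit lets base points move.\<close>

lemma clarke_real_subadditive:
  assumes \<phi>: "locally_lipschitz \<phi>"
  shows "clarke_real \<phi> x (d + e) \<le> clarke_real \<phi> x d + clarke_real \<phi> x e"
proof (rule field_le_epsilon)
  fix \<eta> :: real assume "\<eta> > 0"
  let ?F = "nhds x \<times>\<^sub>F at_right (0::real)"
  have "filterlim (\<lambda>z. (fst z + snd z *\<^sub>R e, snd z)) ?F ?F"
    using filterlim_Pair[OF tendsto_clarke_shift[of e x] filterlim_snd[of "at_right 0" "nhds x"]]
    by (simp add: case_prod_unfold)
  moreover have "\<forall>\<^sub>F (y, h) in ?F. (\<phi> (y + h *\<^sub>R d) - \<phi> y) / h < clarke_real \<phi> x d + \<eta> / 2"
    using \<phi> \<open>\<eta> > 0\<close> by (intro eventually_clarke_quotient_less) auto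
  ultimately have "\<forall>\<^sub>F (y, h) in ?F.
      (\<phi> (y + h *\<^sub>R e + h *\<^sub>R d) - \<phi> (y + h *\<^sub>R e)) / h < clarke_real \<phi> x d + \<eta> / 2"
    by (auto dest: eventually_compose_filterlim simp: case_prod_unfold)
  moreover have "\<forall>\<^sub>F (y, h) in ?F. (\<phi> (y + h *\<^sub>R e) - \<phi> y) / h < clarke_real \<phi> x e + \<eta> / 2"
    using \<phi> \<open>\<eta> > 0\<close> by (intro eventually_clarke_quotient_less) auto
  ultimately have "\<forall>\<^sub>F (y, h) in ?F. (\<phi> (y + h *\<^sub>R (d + e)) - \<phi> y) / h
      \<le> clarke_real \<phi> x d + clarke_real \<phi> x e + \<eta>"
    by eventually_elim (auto simp: algebra_simps diff_divide_distrib)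
  then show "clarke_real \<phi> x (d + e) \<le> clarke_real \<phi> x d + clarke_real \<phi> x e + \<eta>"
    by (rule clarke_real_leI[OF \<phi>])
qed

text \<open>Substituting the step \<open>c * h\<close> for \<open>h\<close> preserves the limit and
  multiplies the quotient by \<open>1 / c\<close>.\<close>

lemma clarke_real_scaleR_le:
  assumes \<phi>: "locally_lipschitz \<phi>" and c: "c > 0"
  shows "clarke_real \<phi> x (c *\<^sub>R d) \<le> c * clarke_real \<phi> x d"
proof -
  have "clarke_real \<phi> x (c *\<^sub>R d) / c \<le> clarke_real \<phi> x d"
  proof (rule dense_ge)
    fix b assume b: "clarke_real \<phi> x d < b"
    let ?F = "nhds x \<times>\<^sub>F at_right (0::real)"
    have "filterlim (\<lambda>h. c * h) (at_right 0) (at_right (0::real))"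
      using filterlim_times_pos[OF filterlim_ident c, of 0 0] by (simp add: mult.commute)
    then have "filterlim (\<lambda>z. (fst z, c * snd z)) ?F ?F"
      by (intro filterlim_Pair filterlim_fst filterlim_compose[OF _ filterlim_snd])
    from eventually_compose_filterlim[OF eventually_clarke_quotient_less[OF \<phi> b] this]
    have "\<forall>\<^sub>F (y, h) in ?F. (\<phi> (y + h *\<^sub>R (c *\<^sub>R d)) - \<phi> y) / (c * h) < b"
      by (simp add: case_prod_unfold mult.commute)
    then have "\<forall>\<^sub>F (y, h) in ?F. (\<phi> (y + h *\<^sub>R (c *\<^sub>R d)) - \<phi> y) / h \<le> c * b"
      using eventually_clarke_pos by eventually_elim (use c in \<open>auto simp: field_simps\<close>)
    then have "clarke_real \<phi> x (c *\<^sub>R d) \<le> c * b" by (rule clarke_real_leI[OF \<phi>])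
    then show "clarke_real \<phi> x (c *\<^sub>R d) / c \<le> b" using c by (simp add: field_simps)
  qed
  then show ?thesis using c by (simp add: field_simps)
qed

lemma clarke_real_scaleR:
  assumes \<phi>: "locally_lipschitz \<phi>" and c: "c > 0"
  shows "clarke_real \<phi> x (c *\<^sub>R d) = c * clarke_real \<phi> x d"
proof (rule antisym)
  show "clarke_real \<phi> x (c *\<^sub>R d) \<le> c * clarke_real \<phi> x d"
    by (rule clarke_real_scaleR_le[OF assms])
  show "c * clarke_real \<phi> x d \<le> clarke_real \<phi> x (c *\<^sub>R d)"
    using clarke_real_scaleR_le[OF \<phi>, of "1 / c" x "c *\<^sub>R d"] c by (simp add: field_simps)
qed

section \<open>The Clarke subdifferential as a compact convex set\<close>

lemma clarke_subdiff_eq: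
  assumes "locally_lipschitz \<phi>"
  shows "clarke_subdiff \<phi> x = {s. \<forall>d. s \<bullet> d \<le> clarke_real \<phi> x d}"
  using assms by (simp add: clarke_subdiff_def ereal_clarke_real)

text \<open>The subdifferential is an intersection of half-spaces, bounded by the Lipschitz
  constant. The directional derivative is sublinear, so Hahn-Banach provides a subgradient attaining
  it in each direction.\<close>

lemma supports_clarke_subdiff:
  assumes \<phi>: "locally_lipschitz \<phi>"
  shows "supports (clarke_subdiff \<phi> x) (clarke_real \<phi> x)"
proof -
  have eq: "clarke_subdiff \<phi> x = (\<Inter>d. {s. d \<bullet> s \<le> clarke_real \<phi> x d})"
    using \<phi> by (auto simp: clarke_subdiff_eq inner_commute)
  obtain L where L: "\<And>d. \<forall>\<^sub>F (y, h) in nhds x \<times>\<^sub>F at_right 0.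
      \<bar>(\<phi> (y + h *\<^sub>R d) - \<phi> y) / h\<bar> \<le> L * norm d"
    using clarke_quotient_bounded[OF \<phi>] by blast
  have L': "clarke_real \<phi> x d \<le> L * norm d" for d
    by (rule clarke_real_leI[OF \<phi>]) (rule eventually_mono[OF L[of d]], auto simp del: abs_divide)
  have "norm s \<le> L" if "s \<in> clarke_subdiff \<phi> x" "s \<noteq> 0" for s
  proof -
    have "norm s * norm s \<le> L * norm s"
      using that(1) L'[of s] \<phi>
      by (metis (mono_tags, lifting) clarke_subdiff_eq mem_Collect_eq norm_eq_square order_trans
          power2_eq_square power2_norm_eq_inner)
    then show ?thesis using that(2) by simp
  qed
  \<comment> \<open>\<open>L\<close> was obtained without a sign, so the absolute value covers
    \<open>s = 0\<close>.\<close>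
  then have "norm s \<le> \<bar>L\<bar>" if "s \<in> clarke_subdiff \<phi> x" for s
    using that by (cases "s = 0") force+
  then have "bounded (clarke_subdiff \<phi> x)" by (auto simp: bounded_iff)
  moreover have "closed (clarke_subdiff \<phi> x)"
    unfolding eq by (intro closed_INT ballI closed_halfspace_le)
  moreover have "convex (clarke_subdiff \<phi> x)"
    unfolding eq by (intro convex_INT convex_halfspace_le)
  moreover have "\<exists>s\<in>clarke_subdiff \<phi> x. clarke_real \<phi> x d \<le> s \<bullet> d" for d
    using sublinear_support_attained[of "clarke_real \<phi> x" d]
      clarke_real_subadditive[OF \<phi>] clarke_real_scaleR[OF \<phi>] \<phi>
    by (auto simp: clarke_subdiff_eq)
  ultimately show ?thesis by (auto simp: supports_def compact_eq_bounded_closed)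
qed

lemma clarke_subdiff_nonempty:
  "locally_lipschitz \<phi> \<Longrightarrow> clarke_subdiff \<phi> x \<noteq> {}"
  using supports_clarke_subdiff[of \<phi> x] by (auto simp: supports_def)

section \<open>Components and continuity of locally Lipschitz maps\<close>

lemma locally_lipschitz_component:
  fixes g :: "'a::metric_space \<Rightarrow> real ^ 'q"
  assumes "locally_lipschitz g"
  shows "locally_lipschitz (\<lambda>y. g y $ j)"
  unfolding locally_lipschitz_def
proof
  fix x
  obtain r L where r: "r > 0" "L-lipschitz_on (ball x r) g"
    using assms by (metis locally_lipschitz_def)
  then have "L-lipschitz_on (ball x r) (\<lambda>y. g y $ j)"
    unfolding lipschitz_on_def using dist_vec_nth_le order_trans by blast
  with r show "\<exists>r>0. \<exists>L. L-lipschitz_on (ball x r) (\<lambda>y. g y $ j)" by blast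
qed

lemma locally_lipschitz_continuous_on:
  assumes "locally_lipschitz \<phi>"
  shows "continuous_on S \<phi>"
proof -
  have "isCont \<phi> x" for x
  proof -
    obtain r L where "r > 0" "L-lipschitz_on (ball x r) \<phi>"
      using assms by (metis locally_lipschitz_def)
    then show ?thesis
      using lipschitz_on_continuous_on continuous_on_interior[of "ball x r" \<phi> x] by force
  qed
  then show ?thesis by (simp add: continuous_at_imp_continuous_on)
qed

text \<open>Turns a first-order inequality valid in every direction into the AKKT inclusion, by
  duality for the Minkowski sum of the subdifferentials.\<close>

lemma multiplier_rule:
  fixes g :: "'a::euclidean_space \<Rightarrow> real ^ 'q"
  assumes f: "locally_lipschitz f" and g: "locally_lipschitz g"
    and u: "\<And>j. 0 \<le> u j"
    and le: "\<And>d. w \<bullet> d \<le> clarke_real f x d + (\<Sum>j\<in>UNIV. u j * clarke_real (\<lambda>y. g y $ j) x d)"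
  shows "w \<in> clarke_subdiff f x + weighted_subdiff_sum g UNIV u x"
proof (rule supports_memI[OF _ le])
  show "supports (clarke_subdiff f x + weighted_subdiff_sum g UNIV u x)
      (\<lambda>d. clarke_real f x d + (\<Sum>j\<in>UNIV. u j * clarke_real (\<lambda>y. g y $ j) x d))"
    unfolding weighted_subdiff_sum_def using f g u
    by (intro supports_plus supports_sum supports_scaleR supports_clarke_subdiff
        locally_lipschitz_component) auto
qed

section \<open>Penalization\<close>

text \<open>This is the squared Euclidean distance from \<open>g y\<close> to the nonpositive
  orthant.\<close>

definition infeasibility :: "('a \<Rightarrow> real ^ 'q) \<Rightarrow> 'a \<Rightarrow> real" where
  "infeasibility g y = (\<Sum>j\<in>UNIV. (max 0 (g y $ j))\<^sup>2)"

lemma infeasibility_nonneg: "infeasibility g y \<ge> 0"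
  by (simp add: infeasibility_def sum_nonneg)

lemma infeasibility_eq_0_iff: "infeasibility g y = 0 \<longleftrightarrow> feasible g y"
proof -
  have "max 0 t = 0 \<longleftrightarrow> t \<le> 0" for t :: real by auto
  then show ?thesis
    by (simp add: infeasibility_def feasible_def sum_nonneg_eq_0_iff less_eq_vec_def)
qed

text \<open>The proximal term separates the sphere around \<open>xbar\<close> from its centre, and
  its gradient \<open>y - xbar\<close> supplies the AKKT error.\<close>

definition penalized ::
    "('a::euclidean_space \<Rightarrow> real) \<Rightarrow> ('a \<Rightarrow> real ^ 'q) \<Rightarrow> 'a \<Rightarrow> real \<Rightarrow> 'a \<Rightarrow> real" where
  "penalized f g xbar K y = f y + K / 2 * infeasibility g y + (norm (y - xbar))\<^sup>2 / 2"

text \<open>The base point can be frozen at \<open>x\<close> because every property eventual in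
  \<open>nhds x\<close> holds at \<open>x\<close> itself.\<close>

lemma eventually_at_right_clarke:
  assumes "\<forall>\<^sub>F (y, h) in nhds x \<times>\<^sub>F at_right (0::real). P y h"
  shows "\<forall>\<^sub>F h in at_right 0. P x h"
proof -
  obtain Q R where "eventually Q (nhds x)" and R: "eventually R (at_right 0)"
    and QR: "\<And>y h. Q y \<Longrightarrow> R h \<Longrightarrow> P y h"
    using assms by (auto simp: eventually_prod_filter)
  then have "Q x" by (simp add: eventually_nhds_x_imp_x)
  with QR show ?thesis using R by (auto elim: eventually_mono)
qed

text \<open>The reason is that the squared positive part has derivative \<open>2 max 0 a\<close>, which is 2-Lipschitz.\<close>

lemma pos_part_square_le:
  fixes a b :: real
  shows "(max 0 b)\<^sup>2 \<le> (max 0 a)\<^sup>2 + 2 * max 0 a * (b - a) + (b - a)\<^sup>2"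
proof (cases "a \<ge> 0")
  case True
  have "(max 0 b)\<^sup>2 \<le> b\<^sup>2" by (simp add: max_def)
  also have "b\<^sup>2 = a\<^sup>2 + 2 * a * (b - a) + (b - a)\<^sup>2" by algebra
  finally show ?thesis using True by simp
next
  case False
  then have "(max 0 b)\<^sup>2 \<le> \<bar>b - a\<bar>\<^sup>2" by (intro power_mono) auto
  with False show ?thesis by simp
qed

text \<open>Minimality is tested along each ray from \<open>x\<close>.
  \<open>pos_part_square_le\<close> linearizes the penalty, with multipliers
  \<open>K * max 0 (g x $ j)\<close> and a remainder quadratic in the step, and the step then tends
  to 0.\<close>

lemma penalized_stationary:
  fixes g :: "'a::euclidean_space \<Rightarrow> real ^ 'q"
  assumes f: "locally_lipschitz f" and g: "locally_lipschitz g" and K: "K \<ge> 0"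
    and min: "\<forall>\<^sub>F y in nhds x. penalized f g xbar K x \<le> penalized f g xbar K y"
  shows "xbar - x \<in> clarke_subdiff f x + weighted_subdiff_sum g UNIV (\<lambda>j. K * max 0 (g x $ j)) x"
proof (rule multiplier_rule[OF f g])
  define u where "u j = K * max 0 (g x $ j)" for j
  have u: "u j \<ge> 0" for j using K by (simp add: u_def)
  then show "0 \<le> K * max 0 (g x $ j)" for j by (simp add: u_def)
  let ?p = "\<lambda>j. clarke_real (\<lambda>y. g y $ j) x"
  fix d
  note gj = locally_lipschitz_component[OF g]
  have "\<forall>j. \<exists>B. \<forall>d. \<forall>\<^sub>F (y, h) in nhds x \<times>\<^sub>F at_right 0.
      \<bar>(g (y + h *\<^sub>R d) $ j - g y $ j) / h\<bar> \<le> B * norm d"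
  proof
    fix j show "\<exists>B. \<forall>d. \<forall>\<^sub>F (y, h) in nhds x \<times>\<^sub>F at_right 0.
      \<bar>(g (y + h *\<^sub>R d) $ j - g y $ j) / h\<bar> \<le> B * norm d"
      by (rule clarke_quotient_bounded[OF gj[of j], of x]) blast
  qed
  from choice[OF this] obtain B where B: "\<forall>j. \<forall>d. \<forall>\<^sub>F (y, h) in nhds x \<times>\<^sub>F at_right 0.
      \<bar>(g (y + h *\<^sub>R d) $ j - g y $ j) / h\<bar> \<le> B j * norm d"
    by blast
  \<comment> \<open>An upper limit bounds the quotients only up to a slack \<open>\<eta>\<close>,
    which is sent to 0 after \<open>h\<close>.\<close>
  have main: "(xbar - x) \<bullet> d \<le> (clarke_real f x d + \<eta>) + (\<Sum>j\<in>UNIV. u j * (?p j d + \<eta>))"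
    if \<eta>: "\<eta> > 0" for \<eta>
  proof (rule tendsto_lowerbound)
    \<comment> \<open>The last two summands bound the quadratic remainders of the penalty and of the
      proximal term, divided by \<open>h\<close>.\<close>
    let ?M = "\<lambda>h. (clarke_real f x d + \<eta>) + (\<Sum>j\<in>UNIV. u j * (?p j d + \<eta>))
      + K / 2 * (\<Sum>j\<in>UNIV. h * (B j * norm d)\<^sup>2) + h / 2 * (norm d)\<^sup>2"
    have h0: "((\<lambda>h. h) \<longlongrightarrow> 0) (at_right (0::real))" by (rule tendsto_ident_at)
    have "(?M \<longlongrightarrow> (clarke_real f x d + \<eta>) + (\<Sum>j\<in>UNIV. u j * (?p j d + \<eta>))
      + K / 2 * (\<Sum>j\<in>(UNIV::'q set). 0 * (B j * norm d)\<^sup>2) + 0 / 2 * (norm d)\<^sup>2) (at_right 0)"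
      by (intro tendsto_intros h0) auto
    then show "(?M \<longlongrightarrow> (clarke_real f x d + \<eta>) + (\<Sum>j\<in>UNIV. u j * (?p j d + \<eta>))) (at_right 0)"
      by simp
    have "\<forall>\<^sub>F h in at_right 0. (f (x + h *\<^sub>R d) - f x) / h < clarke_real f x d + \<eta>"
      by (intro eventually_at_right_clarke eventually_clarke_quotient_less[OF f]) (use \<eta> in simp)
    moreover have "\<forall>\<^sub>F h in at_right 0. \<forall>j. (g (x + h *\<^sub>R d) $ j - g x $ j) / h < ?p j d + \<eta>"
      by (intro eventually_all_finite eventually_at_right_clarke
          eventually_clarke_quotient_less[OF gj]) (use \<eta> in simp)
    moreover have "\<forall>\<^sub>F h in at_right 0. \<forall>j. \<bar>(g (x + h *\<^sub>R d) $ j - g x $ j) / h\<bar> \<le> B j * norm d"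
      by (intro eventually_all_finite eventually_at_right_clarke B[rule_format])
    moreover have "\<forall>\<^sub>F h in at_right 0. penalized f g xbar K x \<le> penalized f g xbar K (x + h *\<^sub>R d)"
    proof (rule eventually_compose_filterlim[OF min])
      have "((\<lambda>h. x + h *\<^sub>R d) \<longlongrightarrow> x + 0 *\<^sub>R d) (at_right 0)"
        by (intro tendsto_intros h0)
      then show "((\<lambda>h. x + h *\<^sub>R d) \<longlongrightarrow> x) (at_right 0)" by simp
    qed
    moreover have "\<forall>\<^sub>F h in at_right (0::real). h > 0" by (rule eventually_at_right_less)
    ultimately show "\<forall>\<^sub>F h in at_right 0. (xbar - x) \<bullet> d \<le> ?M h"
    proof eventually_elim
      case (elim h)
      define q where "q j = (g (x + h *\<^sub>R d) $ j - g x $ j) / h" for j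
      define F where "F = (f (x + h *\<^sub>R d) - f x) / h"
      have h: "h > 0" by fact
      have gq: "g (x + h *\<^sub>R d) $ j - g x $ j = h * q j" for j using h by (simp add: q_def)
      have fF: "f (x + h *\<^sub>R d) - f x = h * F" using h by (simp add: F_def)
      have "infeasibility g (x + h *\<^sub>R d) \<le> (\<Sum>j\<in>UNIV. (max 0 (g x $ j))\<^sup>2
          + 2 * max 0 (g x $ j) * (h * q j) + (h * q j)\<^sup>2)"
        unfolding infeasibility_def
        by (intro sum_mono) (metis gq pos_part_square_le)
      also have "\<dots> = infeasibility g x
          + 2 * h * (\<Sum>j\<in>UNIV. max 0 (g x $ j) * q j) + h * (\<Sum>j\<in>UNIV. h * (q j)\<^sup>2)"
        by (simp add: infeasibility_def sum.distrib sum_distrib_left power2_eq_square mult_ac)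
      finally have "K / 2 * infeasibility g (x + h *\<^sub>R d) \<le> K / 2 * (infeasibility g x
          + 2 * h * (\<Sum>j\<in>UNIV. max 0 (g x $ j) * q j) + h * (\<Sum>j\<in>UNIV. h * (q j)\<^sup>2))"
        using K by (intro mult_left_mono) auto
      also have "\<dots> = K / 2 * infeasibility g x
          + h * (\<Sum>j\<in>UNIV. u j * q j) + h * (K / 2 * (\<Sum>j\<in>UNIV. h * (q j)\<^sup>2))"
        by (simp add: u_def sum_distrib_left algebra_simps)
      finally have I: "K / 2 * infeasibility g (x + h *\<^sub>R d) \<le> \<dots>" .
      have N: "(norm (x + h *\<^sub>R d - xbar))\<^sup>2 / 2 =
          (norm (x - xbar))\<^sup>2 / 2 + h * (- ((xbar - x) \<bullet> d)) + h * (h / 2 * (norm d)\<^sup>2)"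
        unfolding power2_norm_eq_inner
        by (simp add: field_simps inner_commute power2_eq_square inner_diff_left inner_diff_right
              inner_add_left inner_add_right)
      \<comment> \<open>This is minimality after cancelling the values at \<open>x\<close>; every
        summand carries a factor \<open>h\<close>.\<close>
      have "0 \<le> h * F + h * (\<Sum>j\<in>UNIV. u j * q j) + h * (K / 2 * (\<Sum>j\<in>UNIV. h * (q j)\<^sup>2))
          + h * (- ((xbar - x) \<bullet> d)) + h * (h / 2 * (norm d)\<^sup>2)"
        using elim(4) I N fF unfolding penalized_def by linarith
      also have "\<dots> = h * (F + (\<Sum>j\<in>UNIV. u j * q j) + K / 2 * (\<Sum>j\<in>UNIV. h * (q j)\<^sup>2)
          - (xbar - x) \<bullet> d + h / 2 * (norm d)\<^sup>2)"
        by (simp only: distrib_left right_diff_distrib mult_minus_right diff_conv_add_uminus)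
      finally have "(xbar - x) \<bullet> d \<le> F + (\<Sum>j\<in>UNIV. u j * q j)
          + K / 2 * (\<Sum>j\<in>UNIV. h * (q j)\<^sup>2) + h / 2 * (norm d)\<^sup>2"
        using h by (simp add: zero_le_mult_iff)
      also have "\<dots> \<le> ?M h"
      proof (intro add_mono order_refl)
        show "F \<le> clarke_real f x d + \<eta>" using elim(1) by (simp add: F_def)
        show "(\<Sum>j\<in>UNIV. u j * q j) \<le> (\<Sum>j\<in>UNIV. u j * (?p j d + \<eta>))"
          using elim(2) by (intro sum_mono mult_left_mono u) (simp add: q_def less_imp_le)
        have "(q j)\<^sup>2 \<le> (B j * norm d)\<^sup>2" for j
        proof -
          have "\<bar>q j\<bar> \<le> B j * norm d" using elim(3) by (simp add: q_def)
          then have "\<bar>q j\<bar>\<^sup>2 \<le> (B j * norm d)\<^sup>2" by (intro power_mono) auto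
          then show ?thesis by simp
        qed
        then show "K / 2 * (\<Sum>j\<in>UNIV. h * (q j)\<^sup>2) \<le> K / 2 * (\<Sum>j\<in>UNIV. h * (B j * norm d)\<^sup>2)"
          using K h by (intro mult_left_mono sum_mono) auto
      qed
      finally show ?case .
    qed
  qed simp
  have "(xbar - x) \<bullet> d \<le> clarke_real f x d + (\<Sum>j\<in>UNIV. u j * ?p j d)"
  proof (rule tendsto_lowerbound)
    let ?M = "\<lambda>\<eta>. (clarke_real f x d + \<eta>) + (\<Sum>j\<in>UNIV. u j * (?p j d + \<eta>))"
    have "(?M \<longlongrightarrow> (clarke_real f x d + 0) + (\<Sum>j\<in>UNIV. u j * (?p j d + 0))) (at_right 0)"
      by (intro tendsto_intros tendsto_ident_at)
    then show "(?M \<longlongrightarrow> clarke_real f x d + (\<Sum>j\<in>UNIV. u j * ?p j d)) (at_right 0)"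
      by simp
    show "\<forall>\<^sub>F \<eta> in at_right 0. (xbar - x) \<bullet> d \<le> ?M \<eta>"
      using eventually_at_right_less[of 0] by eventually_elim (rule main)
  qed simp
  then show "(xbar - x) \<bullet> d \<le> clarke_real f x d + (\<Sum>j\<in>UNIV. K * max 0 (g x $ j) * ?p j d)"
    by (simp add: u_def)
qed

text \<open>The multipliers are positive only at violated constraints; this later yields both
  complementarity and the sign condition of quasinormality.\<close>

lemma approximate_kkt_point:
  fixes g :: "'a::euclidean_space \<Rightarrow> real ^ 'q"
  assumes f: "locally_lipschitz f" and g: "locally_lipschitz g"
    and min: "local_minimizer f g xbar" and e: "e > 0"
  shows "\<exists>x\<in>ball xbar e. \<exists>u. (\<forall>j. 0 \<le> u j) \<and> (\<forall>j. u j > 0 \<longrightarrow> g x $ j > 0) \<and>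
    xbar - x \<in> clarke_subdiff f x + weighted_subdiff_sum g UNIV u x"
proof -
  note cont_f = locally_lipschitz_continuous_on[OF f]
  have cont_P: "continuous_on S (infeasibility g)" for S
    unfolding infeasibility_def [abs_def]
    by (intro continuous_intros locally_lipschitz_continuous_on locally_lipschitz_component[OF g])
  have feas: "feasible g xbar" using min by (simp add: local_minimizer_def)
  obtain r0 where r0: "r0 > 0" "\<And>y. dist y xbar < r0 \<Longrightarrow> feasible g y \<Longrightarrow> f xbar \<le> f y"
    using min by (auto simp: local_minimizer_def eventually_nhds_metric)
  \<comment> \<open>Halving keeps the closed ball of radius \<open>r\<close> inside both open
    balls.\<close>
  define r where "r = min r0 e / 2"
  have r: "r > 0" "r < r0" "r < e" using r0(1) e by (auto simp: r_def)
  have loc: "f xbar \<le> f y" if "dist xbar y \<le> r" "feasible g y" for y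
    using r0(2)[of y] that r by (simp add: dist_commute)
  \<comment> \<open>Otherwise points of the sphere with penalized value at most
    \<open>f xbar\<close> would accumulate at some \<open>l\<close>. The growing penalty makes
    \<open>l\<close> feasible, while the proximal term leaves \<open>f l\<close> at least
    \<open>r\<^sup>2 / 2\<close> below \<open>f xbar\<close>.\<close>
  have "\<exists>k::nat. \<forall>y\<in>sphere xbar r. f xbar < penalized f g xbar (real k) y"
  proof (rule ccontr)
    assume "\<not> ?thesis"
    then have "\<forall>k::nat. \<exists>y\<in>sphere xbar r. penalized f g xbar (real k) y \<le> f xbar"
      by (auto simp: not_less)
    then obtain y where y: "\<And>k. y k \<in> sphere xbar r"
      and yle: "\<And>k. penalized f g xbar (real k) (y k) \<le> f xbar"
      by metis
    obtain l s where l: "l \<in> sphere xbar r" and s: "strict_mono s" and lim: "(y \<circ> s) \<longlonglongrightarrow> l"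
      using compact_sphere[of xbar r] y unfolding compact_def by metis
    have ys: "f (y k) + real k / 2 * infeasibility g (y k) + r\<^sup>2 / 2 \<le> f xbar" for k
      using yle[of k] y[of k] by (simp add: penalized_def dist_norm norm_minus_commute)
    have flim: "(\<lambda>k. f (y (s k))) \<longlonglongrightarrow> f l"
      and Plim: "(\<lambda>k. infeasibility g (y (s k))) \<longlonglongrightarrow> infeasibility g l"
      using continuous_on_tendsto_compose[OF cont_f[of UNIV] lim]
        continuous_on_tendsto_compose[OF cont_P[of UNIV] lim]
      by (auto simp: o_def)
    have inv: "(\<lambda>k. 1 / real (s k)) \<longlonglongrightarrow> 0"
      using LIMSEQ_subseq_LIMSEQ[OF lim_1_over_n s] by (simp add: o_def)
    have "infeasibility g l \<le> 0"
    proof (rule LIMSEQ_le[OF Plim])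
      have "(\<lambda>k. 2 * (f xbar - f (y (s k))) * (1 / real (s k))) \<longlonglongrightarrow> 2 * (f xbar - f l) * 0"
        by (intro tendsto_intros flim inv)
      then show "(\<lambda>k. 2 * (f xbar - f (y (s k))) * (1 / real (s k))) \<longlonglongrightarrow> 0" by simp
      \<comment> \<open>Restricting to \<open>k \<ge> 1\<close> makes \<open>s k\<close> positive,
        so that division by it is legitimate.\<close>
      have "infeasibility g (y (s k)) \<le> 2 * (f xbar - f (y (s k))) * (1 / real (s k))" if "k \<ge> 1" for k
      proof -
        have pos: "real (s k) > 0" using seq_suble[OF s, of k] that by simp
        have "real (s k) / 2 * infeasibility g (y (s k)) \<le> f xbar - f (y (s k))"
          using ys[of "s k"] zero_le_power2[of r] by linarith
        then show ?thesis using pos by (simp add: field_simps)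
      qed
      then show "\<exists>N. \<forall>k\<ge>N. infeasibility g (y (s k)) \<le> 2 * (f xbar - f (y (s k))) * (1 / real (s k))"
        by blast
    qed
    then have "feasible g l"
      using infeasibility_nonneg[of g l] infeasibility_eq_0_iff[of g l] by simp
    then have "f xbar \<le> f l" using l by (intro loc) auto
    moreover have "f l + r\<^sup>2 / 2 \<le> f xbar"
    proof (rule LIMSEQ_le_const2)
      show "(\<lambda>k. f (y (s k)) + r\<^sup>2 / 2) \<longlonglongrightarrow> f l + r\<^sup>2 / 2" by (intro tendsto_intros flim)
      show "\<exists>N. \<forall>k\<ge>N. f (y (s k)) + r\<^sup>2 / 2 \<le> f xbar"
      proof (intro exI allI impI)
        fix k
        have "real (s k) / 2 * infeasibility g (y (s k)) \<ge> 0" by (simp add: infeasibility_nonneg)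
        then show "f (y (s k)) + r\<^sup>2 / 2 \<le> f xbar" using ys[of "s k"] by linarith
      qed
    qed
    moreover have "r\<^sup>2 > 0" using r by simp
    ultimately show False by linarith
  qed
  then obtain k :: nat where k: "\<And>y. y \<in> sphere xbar r \<Longrightarrow> f xbar < penalized f g xbar (real k) y"
    by blast
  have xbar: "penalized f g xbar (real k) xbar = f xbar"
    using feas by (simp add: penalized_def infeasibility_eq_0_iff[THEN iffD2])
  have "continuous_on (cball xbar r) (penalized f g xbar (real k))"
    unfolding penalized_def [abs_def] by (intro continuous_intros cont_f cont_P) auto
  then obtain x where x: "x \<in> cball xbar r"
    and xmin: "\<And>y. y \<in> cball xbar r \<Longrightarrow> penalized f g xbar (real k) x \<le> penalized f g xbar (real k) y"
    using continuous_attains_inf[of "cball xbar r" "penalized f g xbar (real k)"] r by auto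
  \<comment> \<open>The centre has value \<open>f xbar\<close>, which is below every value on the
    sphere.\<close>
  have "x \<notin> sphere xbar r"
    using k[of x] xmin[of xbar] r xbar by auto
  then have xball: "x \<in> ball xbar r" using x by auto
  then have "\<forall>\<^sub>F y in nhds x. y \<in> ball xbar r" by (intro eventually_nhds_in_open) auto
  then have "\<forall>\<^sub>F y in nhds x. penalized f g xbar (real k) x \<le> penalized f g xbar (real k) y"
    by eventually_elim (auto intro: xmin)
  from penalized_stationary[OF f g _ this]
  have "xbar - x \<in> clarke_subdiff f x + weighted_subdiff_sum g UNIV (\<lambda>j. real k * max 0 (g x $ j)) x"
    by simp
  moreover have "g x $ j > 0" if "real k * max 0 (g x $ j) > 0" for j
    using that by (auto simp: zero_less_mult_iff max_def split: if_splits)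
  ultimately show ?thesis
    using xball r by (intro bexI[of _ x] exI[of _ "\<lambda>j. real k * max 0 (g x $ j)"]) auto
qed

section \<open>Quasinormality and subMFC\<close>

text \<open>A zero weight collapses a nonempty subdifferential to \<open>{0}\<close>, the neutral
  element of the Minkowski sum; nonemptiness matters because the image of the empty set would be
  empty.\<close>

lemma zero_mem_weighted_subdiff_sum_extend:
  fixes g :: "'a::euclidean_space \<Rightarrow> real ^ 'q"
  assumes g: "locally_lipschitz g" and JA: "J \<subseteq> A" and w: "w \<in> weighted_subdiff_sum g J v x"
  shows "w \<in> weighted_subdiff_sum g A (\<lambda>j. if j \<in> J then v j else 0) x"
proof -
  let ?v = "\<lambda>j. if j \<in> J then v j else 0"
  let ?C = "\<lambda>j. (\<lambda>s. ?v j *\<^sub>R s) ` clarke_subdiff (\<lambda>y. g y $ j) x"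
  have "?C j = 0" if "j \<notin> J" for j
    using that clarke_subdiff_nonempty[OF locally_lipschitz_component[OF g], of j x] by auto
  then have "(\<Sum>j\<in>A. ?C j) = (\<Sum>j\<in>J. ?C j)"
    using JA by (intro sum.mono_neutral_right) auto
  also have "\<dots> = weighted_subdiff_sum g J v x"
    unfolding weighted_subdiff_sum_def by (intro sum.cong) auto
  finally show ?thesis using w by (simp add: weighted_subdiff_sum_def)
qed

lemma quasinormal_imp_subMFC:
  fixes g :: "'a::euclidean_space \<Rightarrow> real ^ 'q"
  assumes f: "locally_lipschitz f" and g: "locally_lipschitz g"
    and min: "local_minimizer f g xbar" and qn: "quasinormal g xbar"
  shows "subMFC f g xbar"
proof -
  have feas: "feasible g xbar" using min by (simp add: local_minimizer_def)
  have "\<forall>m::nat. \<exists>x u. x \<in> ball xbar (inverse (real (Suc m))) \<and> (\<forall>j. 0 \<le> u j) \<and>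
      (\<forall>j. u j > 0 \<longrightarrow> g x $ j > 0) \<and>
      xbar - x \<in> clarke_subdiff f x + weighted_subdiff_sum g UNIV u x"
  proof
    fix m
    have "inverse (real (Suc m)) > 0" by simp
    from approximate_kkt_point[OF f g min this]
    show "\<exists>x u. x \<in> ball xbar (inverse (real (Suc m))) \<and> (\<forall>j. 0 \<le> u j) \<and>
        (\<forall>j. u j > 0 \<longrightarrow> g x $ j > 0) \<and>
        xbar - x \<in> clarke_subdiff f x + weighted_subdiff_sum g UNIV u x"
      by blast
  qed
  then obtain X U where X: "\<And>m. X m \<in> ball xbar (inverse (real (Suc m)))"
    and U: "\<And>m j. 0 \<le> U m j" "\<And>m j. U m j > 0 \<Longrightarrow> g (X m) $ j > 0"
    and kkt: "\<And>m. xbar - X m \<in> clarke_subdiff f (X m) + weighted_subdiff_sum g UNIV (U m) (X m)"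
    unfolding choice_iff by blast
  have Xlim: "X \<longlonglongrightarrow> xbar"
  proof (rule tendsto_dist_iff[THEN iffD2],
      rule tendsto_sandwich[OF _ _ tendsto_const LIMSEQ_inverse_real_of_nat])
    show "\<forall>\<^sub>F m in sequentially. 0 \<le> dist (X m) xbar" by simp
    show "\<forall>\<^sub>F m in sequentially. dist (X m) xbar \<le> inverse (real (Suc m))"
      using X by (auto simp: dist_commute less_imp_le)
  qed
  define V where "V m = {j. g (X m) $ j > 0}" for m
  \<comment> \<open>There are only finitely many sets of constraint indices, so one of them recurs
    infinitely often.\<close>
  obtain m0 where inf: "infinite {m. V m = V m0}"
    using pigeonhole_infinite[of "UNIV :: nat set" V] by (auto simp: finite_subset[OF subset_UNIV])
  define J where "J = V m0"
  obtain \<sigma> :: "nat \<Rightarrow> nat" where \<sigma>: "strict_mono \<sigma>" and \<sigma>J: "\<And>k. V (\<sigma> k) = J"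
    using infinite_enumerate[OF inf] by (auto simp: J_def)
  define x where "x k = X (\<sigma> k)" for k
  define u :: "nat \<Rightarrow> real ^ 'q" where "u k = (\<chi> j. U (\<sigma> k) j)" for k
  \<comment> \<open>Off \<open>J\<close> the value must be positive and tend to 0;
    \<open>Suc\<close> keeps it positive at \<open>k = 0\<close>.\<close>
  define \<delta> :: "nat \<Rightarrow> real ^ 'q" where
    "\<delta> k = (\<chi> j. if j \<in> J then g (x k) $ j else inverse (real (Suc k)))" for k
  have xlim: "x \<longlonglongrightarrow> xbar"
    using LIMSEQ_subseq_LIMSEQ[OF Xlim \<sigma>] by (simp add: o_def x_def[abs_def])
  have inJ: "g (x k) $ j > 0 \<longleftrightarrow> j \<in> J" for k j
    using \<sigma>J[of k] by (auto simp: V_def x_def)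
  have uJ: "u k $ j = 0" if "j \<notin> J" for k j
    using U(1)[of "\<sigma> k" j] U(2)[of "\<sigma> k" j] inJ[of k j] that by (force simp: u_def x_def)
  have glim: "(\<lambda>k. g (x k) $ j) \<longlonglongrightarrow> g xbar $ j" for j
    using continuous_on_tendsto_compose[of UNIV "\<lambda>y. g y $ j", OF _ xlim]
      locally_lipschitz_continuous_on[OF locally_lipschitz_component[OF g]] by simp
  \<comment> \<open>A constraint violated along the whole sequence is nonnegative in the limit and
    nonpositive by feasibility, hence active.\<close>
  have g0: "g xbar $ j = 0" if "j \<in> J" for j
  proof (rule antisym)
    show "g xbar $ j \<le> 0" using feas by (simp add: feasible_def less_eq_vec_def)
    show "0 \<le> g xbar $ j"
      using LIMSEQ_le_const[OF glim[of j], of 0] inJ[of _ j] that by (auto intro: less_imp_le)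
  qed
  have "\<delta> \<longlonglongrightarrow> 0"
  proof (rule vec_tendstoI)
    fix j show "(\<lambda>k. \<delta> k $ j) \<longlonglongrightarrow> 0 $ j"
      using glim[of j] g0[of j] LIMSEQ_inverse_real_of_nat by (cases "j \<in> J") (auto simp: \<delta>_def)
  qed
  moreover have "(\<lambda>k. xbar - x k) \<longlonglongrightarrow> 0"
    using tendsto_diff[OF tendsto_const xlim, of xbar] by simp
  moreover have "xbar - x k \<in> clarke_subdiff f (x k) + weighted_subdiff_sum g UNIV (\<lambda>j. u k $ j) (x k)" for k
    using kkt[of "\<sigma> k"] by (simp add: u_def x_def)
  moreover have "u k \<ge> 0" for k using U(1) by (simp add: u_def less_eq_vec_def)
  moreover have "g (x k) \<le> \<delta> k" for k
  proof -
    have "g (x k) $ j \<le> inverse (real (Suc k))" if "j \<notin> J" for j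
      using inJ[of k j] that
      by (meson inverse_nonnegative_iff_nonnegative linorder_not_le of_nat_0_le_iff order_trans)
    then show ?thesis by (auto simp: \<delta>_def less_eq_vec_def)
  qed
  \<comment> \<open>In each coordinate one factor vanishes: the multiplier off \<open>J\<close>, the
    slack on \<open>J\<close>.\<close>
  moreover have "u k \<bullet> (g (x k) - \<delta> k) = 0" for k
    using uJ[of _ k] by (auto simp: inner_vec_def \<delta>_def intro!: sum.neutral)
  ultimately have akkt: "akkt_sequence f g xbar x u \<delta> (\<lambda>k. xbar - x k)"
    using xlim by (simp add: akkt_sequence_def)
  have act: "J = active_set g (x k) (\<delta> k)" for k
  proof -
    have "g (x k) $ j \<noteq> inverse (real (Suc k))" if "j \<notin> J" for j
      using inJ[of k j] that by (metis inverse_positive_iff_positive of_nat_0_less_iff zero_less_Suc)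
    then show ?thesis by (auto simp: active_set_def \<delta>_def split: if_splits)
  qed
  have JA: "J \<subseteq> active_set g xbar 0" using g0 by (auto simp: active_set_def)
  have "0 \<notin> weighted_subdiff_sum g J v xbar" if v: "nonzero_multiplier J v" for v
  proof
    assume "0 \<in> weighted_subdiff_sum g J v xbar"
    note 0 = zero_mem_weighted_subdiff_sum_extend[OF g JA this]
    let ?v = "\<lambda>j. if j \<in> J then v j else 0"
    have "nonzero_multiplier (active_set g xbar 0) ?v"
      using v JA by (auto simp: nonzero_multiplier_def)
    \<comment> \<open>The extended multiplier is positive only on \<open>J\<close>, where the AKKT
      points already violate the constraints, so the same sequence serves for
      quasinormality.\<close>
    moreover have "\<forall>k. \<forall>j\<in>active_set g xbar 0. ?v j > 0 \<longrightarrow> ?v j * g (x k) $ j > 0"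
      using inJ by auto
    ultimately show False
      using qn 0 xlim unfolding quasinormal_def Let_def by blast
  qed
  then show ?thesis
    using feas JA akkt act unfolding subMFC_def by blast
qed

text \<open>Quasinormality fails because 0 is a subgradient of the norm at the origin and the norm
  is positive at every nonzero point, so the multiplier with all entries 1 violates it.\<close>

lemma subMFC_not_quasinormal_example:
  "\<exists>(f :: real ^ 'n \<Rightarrow> real) (g :: real ^ 'n \<Rightarrow> real ^ 'q) xbar.
     locally_lipschitz f \<and> locally_lipschitz g \<and> local_minimizer f g xbar \<and>
     subMFC f g xbar \<and> \<not> quasinormal g xbar"
proof -
  define f :: "real ^ 'n \<Rightarrow> real" where "f = (\<lambda>_. 0)"
  define g :: "real ^ 'n \<Rightarrow> real ^ 'q" where "g = (\<lambda>y. \<chi> j. norm y)"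
  have gj: "(\<lambda>y. g y $ j) = norm" for j by (simp add: g_def)
  have f: "locally_lipschitz f"
    unfolding locally_lipschitz_def f_def
    by (intro allI exI[of _ 1] conjI exI[of _ 0]) (auto simp: lipschitz_on_def)
  have "dist (g y) (g z) \<le> real CARD('q) * dist y z" for y z
  proof -
    have "norm (g y - g z) \<le> (\<Sum>j\<in>UNIV. \<bar>(g y - g z) $ j\<bar>)" by (rule norm_le_l1_cart)
    also have "\<dots> \<le> (\<Sum>j\<in>(UNIV::'q set). dist y z)"
      by (intro sum_mono) (simp add: g_def dist_norm norm_triangle_ineq3)
    finally show ?thesis by (simp add: dist_norm)
  qed
  then have g: "locally_lipschitz g"
    unfolding locally_lipschitz_def
    by (intro allI exI[of _ 1] conjI exI[of _ "real CARD('q)"]) (auto simp: lipschitz_on_def)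
  have feas: "feasible g 0" by (simp add: feasible_def g_def less_eq_vec_def)
  have min: "local_minimizer f g 0" using feas by (simp add: local_minimizer_def f_def)
  have fsub: "0 \<in> clarke_subdiff f x" for x
    unfolding clarke_subdiff_def clarke_deriv_def f_def
    by (auto intro!: le_Limsup clarke_filter_nontrivial simp: zero_ereal_def[symmetric])
  \<comment> \<open>A negative value would make the quotients based at the origin negative, although
    norms are nonnegative there.\<close>
  have "clarke_real norm (0::real ^ 'n) d \<ge> 0" for d
  proof (rule ccontr)
    have ll: "locally_lipschitz (norm :: real ^ 'n \<Rightarrow> real)"
      using locally_lipschitz_component[OF g, of undefined] by (simp add: gj)
    assume "\<not> 0 \<le> clarke_real norm (0::real ^ 'n) d"
    then have "\<forall>\<^sub>F h in at_right 0. (norm (0 + h *\<^sub>R d) - norm (0::real ^ 'n)) / h < 0"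
      by (intro eventually_at_right_clarke eventually_clarke_quotient_less[OF ll]) simp
    then have "\<forall>\<^sub>F h in at_right (0::real). False"
      using eventually_at_right_less by eventually_elim (auto simp: field_simps divide_less_0_iff mult_less_0_iff)
    then show False by (simp add: trivial_limit_at_right_real)
  qed
  then have gsub: "0 \<in> clarke_subdiff (\<lambda>y. g y $ j) 0" for j
    using locally_lipschitz_component[OF g, of j] by (simp add: clarke_subdiff_eq gj)
  have zero: "0 \<in> weighted_subdiff_sum g J v 0" for J :: "'q set" and v
    unfolding weighted_subdiff_sum_def
  proof (induction J rule: infinite_finite_induct)
    case (insert j J)
    have "v j *\<^sub>R 0 + 0 \<in> (\<lambda>s. v j *\<^sub>R s) ` clarke_subdiff (\<lambda>y. g y $ j) 0 +
        (\<Sum>j\<in>J. (\<lambda>s. v j *\<^sub>R s) ` clarke_subdiff (\<lambda>y. g y $ j) 0)"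
      using gsub insert.IH by blast
    then show ?case using insert.hyps by simp
  qed auto
  have "akkt_sequence f g 0 (\<lambda>_. 0) (\<lambda>_. 0) (\<lambda>k. \<chi> j. inverse (real (Suc k))) (\<lambda>_. 0)"
    unfolding akkt_sequence_def
  proof (intro conjI allI)
    show "0 \<in> clarke_subdiff f 0 + weighted_subdiff_sum g UNIV (\<lambda>j. 0 $ j) 0"
      using set_plus_intro[OF fsub zero] by fastforce
    show "(\<lambda>k. \<chi> j. inverse (real (Suc k))) \<longlonglongrightarrow> (0 :: real ^ 'q)"
      by (rule vec_tendstoI) (use LIMSEQ_inverse_real_of_nat in simp)
  qed (auto simp: g_def less_eq_vec_def)
  moreover have "{} = active_set g 0 (\<chi> j. inverse (real (Suc k)))" for k
    by (auto simp: active_set_def g_def)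
  ultimately have sub: "subMFC f g 0"
    unfolding subMFC_def using feas by blast
  have "\<not> quasinormal g 0"
  proof -
    \<comment> \<open>The vector \<open>1\<close> has all entries 1, so its positive multiples are
      nonzero points tending to the origin.\<close>
    let ?x = "\<lambda>k. inverse (real (Suc k)) *\<^sub>R (1 :: real ^ 'n)"
    have "?x \<longlonglongrightarrow> 0 *\<^sub>R 1"
      by (intro tendsto_intros LIMSEQ_inverse_real_of_nat)
    then have "?x \<longlonglongrightarrow> 0" by simp
    moreover have "\<forall>k. \<forall>j\<in>active_set g 0 0. (1::real) > 0 \<longrightarrow> 1 * g (?x k) $ j > 0"
      by (simp add: g_def)
    moreover have "nonzero_multiplier (active_set g 0 0) (\<lambda>_. 1)"
      by (auto simp: nonzero_multiplier_def active_set_def g_def)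
    ultimately show ?thesis
      using zero unfolding quasinormal_def Let_def by blast
  qed
  with f g min sub show ?thesis by blast
qed

theorem theorem4p7:
  "(\<forall>(f :: real ^ 'n \<Rightarrow> real) (g :: real ^ 'n \<Rightarrow> real ^ 'q) (xbar :: real ^ 'n).
      locally_lipschitz f \<and> locally_lipschitz g \<and> local_minimizer f g xbar \<longrightarrow>
      quasinormal g xbar \<longrightarrow> subMFC f g xbar) \<and>
   (\<exists>(f :: real ^ 'n \<Rightarrow> real) (g :: real ^ 'n \<Rightarrow> real ^ 'q) (xbar :: real ^ 'n).
      locally_lipschitz f \<and> locally_lipschitz g \<and> local_minimizer f g xbar \<and>
      subMFC f g xbar \<and> \<not> quasinormal g xbar)"
  using quasinormal_imp_subMFC subMFC_not_quasinormal_example by blast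

end
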